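(* Let $p$ be a prime and let $d$ be a positive integer properly dividing $p-1$ (that is, $d \mid p-1$ and $d\neq p-1$). Suppose $A, B \subseteq \mathbb{F}_p$ satisfy $A + B = Z_d$, where $Z_d = \{z \in \mathbb{F}_p : z^d = 1\}$. Then $|A|\,|B| = d$ and all sums $a+b$ with $(a,b)\in A\times B$ are distinct (that is, the map $A\times B\to \mathbb{F}_p$, $(a,b)\mapsto a+b$, is injective). In particular, if $d$ is prime, then there are no sets $A,B\subseteq \mathbb{F}_p$, neither of which is a singleton, with $A+B=Z_d$.
   Context: $\mathbb{F}_p$ is the field with $p$ elements. For $A,B\subseteq \mathbb{F}_p$, $A+B=\{a+b : a\in A,\ b\in B\}$. *)

theory Defs
  imports "HOL-Library.Cardinality" "HOL-Library.Set_Algebras" "HOL-Computational_Algebra.Primes"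
begin

text \<open>
  The field with \<open>p\<close> elements is an arbitrary type \<open>'a :: {field, finite}\<close> with \<open>CARD('a) = p\<close>.
  Sumsets \<open>A + B\<close> are those of \<open>HOL-Library.Set_Algebras\<close>.
\<close>

definition Z :: "nat \<Rightarrow> 'a::field set" where
  "Z d = {z. z ^ d = 1}"

end

theory Submission
  imports "HOL-Number_Theory.Residues" Defs "HOL-Computational_Algebra.Polynomial"
begin

text \<open>
  The proof is Stepanov's method, following Hanson and Petridis. Let \<open>n = |A|\<close> and choose weights
  \<open>c a\<close> with \<open>(\<Sum>a\<in>A. c a * a ^ j) = 0\<close> for \<open>j < n - 1\<close> and \<open>= 1\<close> for \<open>j = n - 1\<close>. The
  polynomial \<open>F(x) = (\<Sum>a\<in>A. c a * (x + a) ^ (d + n - 1)) - 1\<close> has degree exactly \<open>d\<close>: its higher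
  coefficients cancel and its coefficient at \<open>x ^ d\<close> is the binomial coefficient
  \<open>(d + n - 1) choose d\<close>, which is nonzero since \<open>d + n - 1 < p\<close>. On the other hand, as
  \<open>(a + b) ^ d = 1\<close>, expanding around any \<open>b \<in> B\<close> shows that \<open>F\<close> vanishes to order at least \<open>n\<close>
  there. Counting roots gives \<open>|A| |B| \<le> d = |A + B|\<close>, and \<open>|A + B| \<le> |A| |B|\<close> is trivial.
\<close>

text \<open>Lagrange interpolation at the points of \<open>A\<close> recovers \<open>P\<close>
  because its degree is below \<open>card A\<close>. The basis polynomials before scaling are monic
  of degree \<open>card A - 1\<close>, so comparing coefficients there gives the sum.\<close>

lemma sum_lagrange_weights:
  fixes A :: "'a::field set" and P :: "'a poly"
  assumes "finite A" "degree P < card A"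
  shows "(\<Sum>a\<in>A. poly P a / (\<Prod>a'\<in>A - {a}. a - a')) = coeff P (card A - 1)"
proof -
  define L where "L a = (\<Prod>a'\<in>A - {a}. [:- a', 1:])" for a
  define w where "w a = (\<Prod>a'\<in>A - {a}. a - a')" for a
  have w: "w a \<noteq> 0" for a
    using assms(1) by (auto simp: w_def)
  have deg: "degree (L a) = card A - 1" if "a \<in> A" for a
    using that assms(1) by (simp add: L_def degree_prod_sum_eq)
  have monic: "coeff (L a) (card A - 1) = 1" if "a \<in> A" for a
    using lead_coeff_prod[of "\<lambda>a'. [:- a', 1:]" "A - {a}"] deg[OF that]
    by (simp flip: L_def)
  have L_eval: "poly (L a) x = (if x = a then w a else 0)" if "x \<in> A" for a x
    using that assms(1) by (auto simp: L_def w_def poly_prod)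
  have "P = (\<Sum>a\<in>A. smult (poly P a / w a) (L a))" (is "_ = ?Q")
  proof (rule poly_eqI_degree)
    fix x assume x: "x \<in> A"
    have "poly ?Q x = (\<Sum>a\<in>A. if x = a then poly P a else 0)"
      unfolding poly_sum by (rule sum.cong) (auto simp: L_eval[OF x] w)
    also have "\<dots> = poly P x"
      using x assms(1) by simp
    finally show "poly P x = poly ?Q x" ..
  next
    have "degree ?Q \<le> card A - 1"
      using assms(1) deg by (intro degree_sum_le) (auto intro: order.trans[OF degree_smult_le])
    then show "degree ?Q < card A"
      using assms(2) by linarith
  qed (fact assms(2))
  then have "coeff P (card A - 1) = coeff ?Q (card A - 1)"
    by (rule arg_cong)
  also have "\<dots> = (\<Sum>a\<in>A. poly P a / w a)"
    using monic by (simp add: coeff_sum)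
  finally show ?thesis
    by (simp add: w_def)
qed

lemma pcompose_power: "(F ^ n) \<circ>\<^sub>p G = (F \<circ>\<^sub>p G) ^ n"
  for F G :: "'a::comm_semiring_1 poly"
  by (induction n) (simp_all add: pcompose_1 pcompose_mult)

text \<open>Correction: the entries above misplace the comments on \<open>pcompose_power\<close>, so
  discard them all. The complete list is the following.\<close>

lemma linear_power_dvd_pcompose_iff:
  fixes F :: "'a::comm_ring_1 poly"
  shows "[:- b, 1:] ^ n dvd F \<longleftrightarrow> (\<forall>k<n. coeff (F \<circ>\<^sub>p [:b, 1:]) k = 0)"
proof -
  have "monom 1 n dvd F \<circ>\<^sub>p [:b, 1:] \<longleftrightarrow> [:- b, 1:] ^ n dvd F"
  proof
    assume "monom 1 n dvd F \<circ>\<^sub>p [:b, 1:]"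
    then obtain G where "F \<circ>\<^sub>p [:b, 1:] = [:0, 1:] ^ n * G"
      by (auto simp: monom_altdef elim: dvdE)
    then have "F \<circ>\<^sub>p [:b, 1:] \<circ>\<^sub>p [:- b, 1:] = ([:0, 1:] ^ n * G) \<circ>\<^sub>p [:- b, 1:]"
      by simp
    then have "F = [:- b, 1:] ^ n * (G \<circ>\<^sub>p [:- b, 1:])"
      by (simp add: pcompose_mult pcompose_power pcompose_pCons flip: pcompose_assoc)
    then show "[:- b, 1:] ^ n dvd F"
      by simp
  next
    assume "[:- b, 1:] ^ n dvd F"
    then obtain G where "F = [:- b, 1:] ^ n * G"
      by (elim dvdE)
    then have "F \<circ>\<^sub>p [:b, 1:] = monom 1 n * (G \<circ>\<^sub>p [:b, 1:])"
      by (simp add: pcompose_mult pcompose_power pcompose_pCons monom_altdef)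
    then show "monom 1 n dvd F \<circ>\<^sub>p [:b, 1:]"
      by simp
  qed
  then show ?thesis
    by (simp add: monom_1_dvd_iff')
qed

lemma sum_order_le_degree:
  fixes F :: "'a::idom poly"
  assumes "F \<noteq> 0" "finite B"
  shows "(\<Sum>b\<in>B. Polynomial.order b F) \<le> degree F"
proof -
  have "(\<Sum>b\<in>B. Polynomial.order b F) = (\<Sum>b\<in>B \<inter> {x. poly F x = 0}. Polynomial.order b F)"
    using assms by (intro sum.mono_neutral_right) (auto simp: order_root)
  also have "\<dots> \<le> (\<Sum>b\<in>{x. poly F x = 0}. Polynomial.order b F)"
    using assms(1) by (intro sum_mono2) (auto simp: poly_roots_finite)
  also have "\<dots> = size (proots F)"
    using assms(1) by (simp add: size_multiset_overloaded_eq)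
  also have "\<dots> \<le> degree F"
    by (rule size_proots_le)
  finally show ?thesis .
qed

lemma card_mult_le_if_sumset_subset_Z:
  fixes A B :: "'a::field set"
  assumes "finite A" "A \<noteq> {}" "finite B" "d > 0"
    and AB: "A + B \<subseteq> Z d"
    and binom: "of_nat ((d + card A - 1) choose d) \<noteq> (0::'a)"
  shows "card A * card B \<le> d"
proof -
  obtain m where m: "card A = Suc m"
    using assms(1,2) by (metis card_0_eq not0_implies_Suc)
  define c where "c a = 1 / (\<Prod>a'\<in>A - {a}. a - a')" for a
  have weights: "(\<Sum>a\<in>A. c a * poly P a) = coeff P m" if "degree P \<le> m" for P
    using sum_lagrange_weights[OF assms(1), of P] that m by (simp add: c_def)
  \<comment> \<open>The polynomial \<open>[:b, 1:] ^ j\<close> is monic of degree \<open>j\<close>,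
    so the moments do not depend on the shift \<open>b\<close>. Shift 0 controls the degree of
    \<open>F\<close>, shifts in \<open>B\<close> its orders of vanishing.\<close>
  have moments: "(\<Sum>a\<in>A. c a * (a + b) ^ j) = (if j = m then 1 else 0)" if "j \<le> m" for b j
  proof -
    have "degree ([:b, 1:] ^ j) = j"
      by (simp add: degree_power_eq)
    then show ?thesis
      using weights[of "[:b, 1:] ^ j"] that
      by (auto simp: poly_power add.commute coeff_linear_power coeff_eq_0)
  qed
  define F where "F = (\<Sum>a\<in>A. smult (c a) ([:a, 1:] ^ (d + m))) - 1"
  have coeff_F: "coeff F i = of_nat ((d + m) choose i) * (\<Sum>a\<in>A. c a * a ^ (d + m - i))"
    if "0 < i" "i \<le> d + m" for i
    using that by (simp add: F_def coeff_sum coeff_linear_poly_power sum_distrib_left mult_ac)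
  \<comment> \<open>For \<open>i\<close> up to \<open>d + m\<close> the exponent
    \<open>d + m - i\<close> is below \<open>m\<close>, so the moment vanishes.\<close>
  have "coeff F i = 0" if i: "i > d" for i
  proof (cases "i \<le> d + m")
    case True
    then show ?thesis
      using i moments[of "d + m - i" 0] by (simp add: coeff_F)
  next
    case False
    then have "coeff ([:a, 1:] ^ (d + m)) i = 0" for a :: 'a
      by (intro coeff_eq_0) (simp add: degree_power_eq)
    then show ?thesis
      using i by (simp add: F_def coeff_sum)
  qed
  then have degF: "degree F \<le> d"
    by (intro degree_le) simp
  have "coeff F d = of_nat ((d + m) choose d)"
    using moments[of m 0] \<open>d > 0\<close> by (simp add: coeff_F)
  then have F0: "F \<noteq> 0"
    using binom m by auto
  have "card A \<le> Polynomial.order b F" if b: "b \<in> B" for b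
  proof -
    have shift: "F \<circ>\<^sub>p [:b, 1:] = (\<Sum>a\<in>A. smult (c a) ([:a + b, 1:] ^ (d + m))) - 1"
      by (simp add: F_def pcompose_diff pcompose_sum pcompose_smult pcompose_power
          pcompose_pCons pcompose_1)
    have "coeff (F \<circ>\<^sub>p [:b, 1:]) k = 0" if k: "k < card A" for k
    proof -
      have km: "k \<le> m"
        using k m by simp
      \<comment> \<open>Membership of \<open>a + b\<close> in \<open>Z d\<close> strips off
        \<open>d\<close> factors and brings the exponent back into the range of
        \<open>moments\<close>.\<close>
      have "(a + b) ^ (d + m - k) = (a + b) ^ (m - k)" if "a \<in> A" for a
      proof -
        have "(a + b) ^ d = 1"
          using AB that b by (auto simp: Z_def)
        then show ?thesis
          using km by (simp add: power_add flip: add_diff_assoc)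
      qed
      \<comment> \<open>Only \<open>k = 0\<close> gives the top moment, and there the term
        \<open>- 1\<close> in \<open>F\<close> cancels it.\<close>
      then have "(\<Sum>a\<in>A. c a * (a + b) ^ (d + m - k)) = (if k = 0 then 1 else 0)"
        using moments[of "m - k" b] km by (auto split: if_splits)
      moreover have "coeff (F \<circ>\<^sub>p [:b, 1:]) k =
          of_nat ((d + m) choose k) * (\<Sum>a\<in>A. c a * (a + b) ^ (d + m - k)) - (if k = 0 then 1 else 0)"
        using km
        by (simp add: shift coeff_sum coeff_linear_poly_power sum_distrib_left mult_ac)
      ultimately show ?thesis
        by simp
    qed
    then have "[:- b, 1:] ^ card A dvd F"
      by (simp add: linear_power_dvd_pcompose_iff)
    then show ?thesis
      using F0 by (simp add: order_divides)
  qed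
  then have "card A * card B \<le> (\<Sum>b\<in>B. Polynomial.order b F)"
    using sum_mono[of B "\<lambda>_. card A" "\<lambda>b. Polynomial.order b F"] by (simp add: mult.commute)
  also have "\<dots> \<le> degree F"
    using F0 assms(3) by (rule sum_order_le_degree)
  finally show ?thesis
    using degF by linarith
qed

text \<open>
  The library has this only for the class \<open>finite_field\<close>, of which \<open>{field, finite}\<close> is not an
  instance.
\<close>
lemma power_card_minus_1_eq_1:
  fixes x :: "'a::{field, finite}"
  assumes "x \<noteq> 0"
  shows "x ^ (CARD('a) - 1) = 1"
proof -
  have "(\<Prod>y\<in>UNIV - {0}. x * y) = (\<Prod>y\<in>UNIV - {0}. y)"
    by (rule prod.reindex_bij_witness[of _ "\<lambda>y. y / x" "\<lambda>y. x * y"]) (use assms in auto)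
  then have "x ^ (CARD('a) - 1) * \<Prod>(UNIV - {0}) = \<Prod>(UNIV - {0})"
    by (simp add: prod.distrib card_Diff_singleton)
  then show ?thesis
    by simp
qed

text \<open>All \<open>d * k\<close> nonzero elements are roots of
  \<open>g (d * k) = g d * Q\<close>. At most \<open>d * k - d\<close> of them are roots of
  \<open>Q\<close>, which leaves at least \<open>d\<close> for \<open>g d\<close>.\<close>

lemma card_Z:
  assumes "d > 0" "d dvd CARD('a::{field, finite}) - 1"
  shows "card (Z d :: 'a set) = d"
proof -
  obtain k where k: "CARD('a) - 1 = d * k"
    using assms(2) by (elim dvdE)
  have "CARD('a) > 1"
    using card_mono[of "UNIV :: 'a set" "{0, 1}"] by simp
  then have "k > 0"
    using k by (cases k) auto
  define g :: "nat \<Rightarrow> 'a poly" where "g j = monom 1 j - 1" for j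
  have root_g: "poly (g j) x = 0 \<longleftrightarrow> x ^ j = 1" for j x
    by (simp add: g_def poly_monom)
  have g: "g j \<noteq> 0" "degree (g j) = j" if "j > 0" for j
  proof -
    have "degree (monom 1 j + - 1 :: 'a poly) = degree (monom 1 j :: 'a poly)"
      by (rule degree_add_eq_left) (use that in \<open>simp add: degree_monom_eq\<close>)
    then show "degree (g j) = j"
      by (simp add: g_def degree_monom_eq)
    then show "g j \<noteq> 0"
      using that by auto
  qed
  have "g d dvd g (d * k)"
    using power_diff_1_eq[of "monom 1 d :: 'a poly" k] by (simp add: g_def monom_power)
  then obtain Q where Q: "g (d * k) = g d * Q"
    by (elim dvdE)
  have Q0: "Q \<noteq> 0"
    using Q g(1)[of "d * k"] \<open>d > 0\<close> \<open>k > 0\<close> by auto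
  then have degQ: "d * k = d + degree Q"
    using arg_cong[OF Q, of degree] g[of d] g(2)[of "d * k"] \<open>d > 0\<close> \<open>k > 0\<close>
    by (simp add: degree_mult_eq)
  have "poly (g (d * k)) x = 0" if "x \<noteq> 0" for x
    using power_card_minus_1_eq_1[OF that] unfolding root_g k .
  then have "UNIV - {0} \<subseteq> Z d \<union> {x. poly Q x = 0}"
    by (auto simp: Q Z_def simp flip: root_g)
  then have "card (UNIV - {0} :: 'a set) \<le> card (Z d \<union> {x. poly Q x = 0})"
    by (intro card_mono) auto
  also have "\<dots> \<le> card (Z d :: 'a set) + card {x. poly Q x = 0}"
    by (rule card_Un_le)
  also have "\<dots> \<le> card (Z d :: 'a set) + degree Q"
    using Q0 by (simp add: card_poly_roots_bound)
  finally have "d \<le> card (Z d :: 'a set)"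
    using k degQ by (simp add: card_Diff_singleton)
  moreover have "card (Z d :: 'a set) \<le> d"
    using card_poly_roots_bound[of "g d"] g[OF \<open>d > 0\<close>] by (simp add: root_g Z_def)
  ultimately show ?thesis
    by simp
qed

lemma prime_not_dvd_choose:
  fixes p n k :: nat
  assumes "prime p" "n < p" "k \<le> n"
  shows "\<not> p dvd n choose k"
proof
  assume "p dvd n choose k"
  then have "p dvd fact n"
    unfolding binomial_fact_lemma[OF assms(3), symmetric] by (rule dvd_mult)
  then show False
    using assms by (simp add: prime_dvd_fact_iff)
qed

lemma sumset_eq_Z:
  fixes A B :: "'a::{field, finite} set"
  assumes "prime (CARD('a))" "d > 0" "d dvd CARD('a) - 1" "d \<noteq> CARD('a) - 1"
    and AB: "A + B = Z d"
  shows "card A * card B = d" and "inj_on (\<lambda>(a, b). a + b) (A \<times> B)"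
proof -
  have cardZ: "card (A + B) = d"
    using card_Z assms(2,3) AB by simp
  have img: "A + B = (\<lambda>(a, b). a + b) ` (A \<times> B)"
    by (auto simp: set_plus_def)
  have "A + B \<noteq> {}"
    using cardZ \<open>d > 0\<close> by auto
  then obtain b where b: "b \<in> B" and "A \<noteq> {}"
    by (auto simp: set_plus_def)
  \<comment> \<open>The translate of \<open>A\<close> by one element of \<open>B\<close> already
    lies in \<open>A + B\<close>.\<close>
  have "card A = card ((\<lambda>a. a + b) ` A)"
    by (simp add: card_image)
  also have "\<dots> \<le> card (A + B)"
    by (rule card_mono) (use b in auto)
  finally have cardA: "card A \<le> d"
    by (simp add: cardZ)
  obtain k where k: "CARD('a) - 1 = d * k"
    using assms(3) by (elim dvdE)
  have "CARD('a) > 1"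
    using assms(1) by (rule prime_gt_1_nat)
  then have "k \<noteq> 0" "k \<noteq> 1"
    using k assms(4) by (auto intro: Nat.gr0I)
  \<comment> \<open>Properness of the divisor \<open>d\<close> enters here: it gives
    \<open>d + card A - 1 \<le> 2 * d - 1 < CARD('a)\<close>, so the binomial coefficient is nonzero
    in the field.\<close>
  then have "2 * d \<le> CARD('a) - 1"
    unfolding k by simp
  then have less: "d + card A - 1 < CARD('a)"
    using cardA \<open>CARD('a) > 1\<close> by linarith
  have "card A > 0"
    using \<open>A \<noteq> {}\<close> by (simp add: card_gt_0_iff)
  have "CHAR('a) = CARD('a)"
    using CHAR_dvd_CARD[where ?'a = 'a] assms(1) by (auto simp: prime_nat_iff)
  then have "of_nat ((d + card A - 1) choose d) \<noteq> (0::'a)"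
    using prime_not_dvd_choose[OF assms(1) less, of d] \<open>card A > 0\<close>
    by (simp add: of_nat_eq_0_iff_char_dvd)
  then have "card A * card B \<le> d"
    using card_mult_le_if_sumset_subset_Z[of A B d] \<open>A \<noteq> {}\<close> \<open>d > 0\<close> AB by simp
  moreover have "d \<le> card A * card B"
    using card_image_le[of "A \<times> B" "\<lambda>(a, b). a + b"] cardZ
    by (simp add: img card_cartesian_product)
  ultimately show eq: "card A * card B = d"
    by simp
  \<comment> \<open>Addition maps \<open>A \<times> B\<close> onto \<open>A + B\<close>, and both
    sets have \<open>d\<close> elements.\<close>
  show "inj_on (\<lambda>(a, b). a + b) (A \<times> B)"
    using cardZ eq by (intro eq_card_imp_inj_on) (simp_all add: card_cartesian_product flip: img)
qed

theorem corollary1p3: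
  fixes p d :: nat
  assumes "prime p"
    and "CARD('a::{field, finite}) = p"
    and "d > 0" and "d dvd p - 1" and "d \<noteq> p - 1"
  shows "(\<forall>A B :: 'a set. A + B = Z d \<longrightarrow>
            card A * card B = d \<and> inj_on (\<lambda>(a, b). a + b) (A \<times> B)) \<and>
         (prime d \<longrightarrow>
            \<not> (\<exists>A B :: 'a set. \<not> is_singleton A \<and> \<not> is_singleton B \<and> A + B = Z d))"
proof -
  have main: "card A * card B = d" "inj_on (\<lambda>(a, b). a + b) (A \<times> B)"
    if "A + B = Z d" for A B :: "'a set"
    using sumset_eq_Z[OF _ _ _ _ that] assms by auto
  have "is_singleton A \<or> is_singleton B" if "prime d" "A + B = Z d" for A B :: "'a set"
    using prime_product[of "card A" "card B"] main(1)[OF that(2)] that(1)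
    by (auto simp: is_singleton_altdef)
  with main show ?thesis
    by blast
qed

end
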